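(* Let $q$ be a prime power, $\theta_q\in\mathbb F_q$ a primitive element and $m>1$ a divisor of $q-1$. If $\pi$ is a $(q-1,m)$-p.a.p. with parameters $(\vec a,\vec b,\vec c)$, then the $\theta_q$-lift $F_{\pi,\theta_q}$ of $\pi$ admits the polynomial representation $$F_{\pi,\theta_q}(x)=\frac1m\sum_{i=1}^m\theta_q^{b_i}\cdot x^{a_i}E_m(x\cdot\theta_q^{-c_i})\in\mathbb F_q[x].$$ In particular, this polynomial representation has at most $m^2$ nonzero coefficients. Moreover, write $q-1=n_1n_2$, where $\mathrm{rad}(n_1)$ divides $\frac{q-1}m$ and $\gcd\left(n_2,\frac{q-1}m\right)=1$; for each $1\le i\le m$, let $A_i'\in[1,n_1]$ be such that $A_i'a_{i-1}\equiv1\pmod{n_1}$, and let $B_i'\in[1,q-1]$ be a solution of $$x\equiv c_{i-1}-A_i'c_i\pmod m,\qquad x\equiv -A_i'b_{i-1}\pmod{n_1};$$ and set $\vec A=(A_m',\dots,A_1')$, $\vec B=(B_m',\dots,B_1')$, $\vec C=(c_m,\dots,c_1)$, so that the inverse $\pi^{-1}$ of $\pi$ is the $(q-1,m)$-p.a.p. with parameters $(\vec A,\vec B,\vec C)$. Denoting by $A_i,B_i,C_i$ the $i$-th coordinates of $\vec A,\vec B,\vec C$, the inverse of $F_{\pi,\theta_q}$ over $\mathbb F_q$ is the permutation polynomial $$F_{\pi^{-1},\theta_q}(x)=\frac1m\sum_{i=1}^m\theta_q^{B_i}\cdot x^{A_i}E_m(x\cdot\theta_q^{-C_i})\in\mathbb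 F_q[x].$$
   Context: For a positive integer $k$, $[1,k]=\{1,\dots,k\}$. For an integer $k>1$ and a positive integer $a$, $\Psi_k(a)$ is the unique element of $[1,k]$ congruent to $a$ modulo $k$. $\mathcal C(m)$ is the set of vectors $\vec c\in[1,m]^m$ whose entries comprise a permutation of $[1,m]$. The $i$-th coordinate of $\vec a$ is denoted $a_i$ (similarly for other vectors), and indices are taken modulo $m$. For $m>1$ dividing $n$, an $(n,m)$-piecewise affine permutation ($(n,m)$-p.a.p.) is a permutation $\pi$ of $[1,n]$ such that there exist $\vec a,\vec b\in[1,n]^m$ and $\vec c\in\mathcal C(m)$ with the property that $\pi(x)=\Psi_n(a_ix+b_i)$ and $\Psi_m(\pi(x))=c_{i+1}$ for any $x\in[1,n]$ with $\Psi_m(x)=c_i$. Then $\pi$ is called the $(n,m)$-p.a.p. with parameters $(\vec a,\vec b,\vec c)$. $\mathbb F_q$ is the finite field with $q$ elements; a primitive element is a generator of the cyclic group $\mathbb F_q^*$. For a $(q-1,m)$-p.a.p. $\pi$, its $\theta_q$-lift is the permutation $F_{\pi,\theta_q}:\mathbb F_q\to\mathbb F_q$ with $F_{\pi,\theta_q}(0)=0$ and $F_{\pi,\theta_q}(\theta_q^i)=\theta_q^{\pi(i)}$ for $1\le i\le q-1$. A polynomial representation of a function $\mathbb F_q\to\mathbb F_q$ is a polynomial in $\mathbb F_q[x]$ whose evaluation map is that function; a permutation polynomial is one whose evaluation map permutes $\mathbb F_q$. $E_m(x)=\sum_{j=0}^{m-1}x^{\frac{(q-1)j}{m}}\in\mathbb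 F_q[x]$. $\mathrm{rad}(N)$ is the product of the distinct prime divisors of $N$, with $\mathrm{rad}(1)=1$. *)

theory Defs
  imports
    "HOL-Computational_Algebra.Computational_Algebra"
    "HOL-Number_Theory.Cong"
    "HOL-Combinatorics.Permutations"
    "HOL-Library.FuncSet"
    "HOL-Library.Cardinality"
begin

text \<open>
  A vector of length \<open>m\<close> is a function \<open>nat \<Rightarrow> nat\<close> of which only the values at
  \<open>1, \<dots>, m\<close> are ever used. A permutation of \<open>{1..n}\<close> is a function that \<open>permutes\<close> this
  set, so it is the identity elsewhere and \<open>inv\<close> is its inverse permutation. The field
  with \<open>q\<close> elements is an arbitrary type of class \<open>{field, finite}\<close> of cardinality \<open>q\<close>.
\<close>

definition Psi :: "nat \<Rightarrow> nat \<Rightarrow> nat" where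
  "Psi k a = (THE r. r \<in> {1..k} \<and> [r = a] (mod k))"

text \<open>
  Indices of vectors are read modulo \<open>m\<close>: the coordinate following \<open>i\<close> is \<open>v (Psi m (i + 1))\<close>,
  and the one preceding \<open>i \<ge> 1\<close> is \<open>v (Psi m (i + m - 1))\<close>, which avoids the argument \<open>0\<close>.
\<close>

definition perm_vectors :: "nat \<Rightarrow> (nat \<Rightarrow> nat) set" where
  "perm_vectors m = {c. bij_betw c {1..m} {1..m}}"

definition is_pap ::
  "nat \<Rightarrow> nat \<Rightarrow> (nat \<Rightarrow> nat) \<Rightarrow> (nat \<Rightarrow> nat) \<Rightarrow> (nat \<Rightarrow> nat) \<Rightarrow> (nat \<Rightarrow> nat) \<Rightarrow> bool"
where
  "is_pap n m \<pi> a b c \<longleftrightarrow>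
     m > 1 \<and> m dvd n \<and> \<pi> permutes {1..n} \<and>
     a \<in> {1..m} \<rightarrow> {1..n} \<and> b \<in> {1..m} \<rightarrow> {1..n} \<and> c \<in> perm_vectors m \<and>
     (\<forall>i\<in>{1..m}. \<forall>x\<in>{1..n}. Psi m x = c i \<longrightarrow>
        \<pi> x = Psi n (a i * x + b i) \<and> Psi m (\<pi> x) = c (Psi m (i + 1)))"

definition primitive_element :: "'a::{field,finite} \<Rightarrow> bool" where
  "primitive_element \<theta> \<longleftrightarrow> range (\<lambda>k::int. \<theta> powi k) = UNIV - {0}"

definition theta_lift :: "'a::{field,finite} \<Rightarrow> (nat \<Rightarrow> nat) \<Rightarrow> 'a \<Rightarrow> 'a" where
  "theta_lift \<theta> \<pi> x =
     (if x = 0 then 0 else \<theta> ^ \<pi> (THE i. i \<in> {1..CARD('a) - 1} \<and> \<theta> ^ i = x))"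

definition poly_representation :: "'a::{field,finite} poly \<Rightarrow> ('a \<Rightarrow> 'a) \<Rightarrow> bool" where
  "poly_representation p f \<longleftrightarrow> (\<forall>x. poly p x = f x)"

definition permutation_poly :: "'a::{field,finite} poly \<Rightarrow> bool" where
  "permutation_poly p \<longleftrightarrow> bij (poly p)"

text \<open>Only used for \<open>m\<close> dividing \<open>CARD('a) - 1\<close>, so that the division is exact.\<close>

definition E_poly :: "nat \<Rightarrow> 'a::{field,finite} poly" where
  "E_poly m = (\<Sum>j=0..m-1. monom 1 ((CARD('a) - 1) * j div m))"

text \<open>
  The substitution of \<open>x \<cdot> \<theta>\<close> to the power \<open>- c i\<close> into \<open>E_poly m\<close> is the composition with
  a linear polynomial. The reduction modulo \<open>x^q - x\<close> is not performed.
\<close>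

definition pap_poly ::
  "'a::{field,finite} \<Rightarrow> nat \<Rightarrow> (nat \<Rightarrow> nat) \<Rightarrow> (nat \<Rightarrow> nat) \<Rightarrow> (nat \<Rightarrow> nat) \<Rightarrow> 'a poly"
where
  "pap_poly \<theta> m a b c =
     smult (1 / of_nat m)
       (\<Sum>i=1..m. smult (\<theta> ^ b i)
          (monom 1 (a i) * pcompose (E_poly m) [:0, \<theta> powi (- int (c i)):]))"

definition rad :: "nat \<Rightarrow> nat" where
  "rad N = \<Prod>(prime_factors N)"

end

theory Submission
  imports Defs
begin

text \<open>
  On \<open>\<theta> ^ k\<close> the factor \<open>E_m (x \<theta> ^ - c_i)\<close> is a geometric sum over an \<open>m\<close>-th root of
  unity, equal to \<open>m\<close> if \<open>k \<equiv> c_i (mod m)\<close> and to \<open>0\<close> otherwise, so exactly one summand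
  survives, and it is \<open>\<theta> ^ (a_i k + b_i)\<close>.

  Since \<open>n\<^sub>2\<close> divides \<open>m\<close>, a residue modulo \<open>n\<close> is determined by its residues modulo \<open>m\<close>
  and modulo \<open>n\<^sub>1\<close>. The conditions on \<open>B'\<close> say that \<open>A'_i \<pi>(y) + B'_i\<close> agrees with \<open>y\<close>
  modulo both, for every \<open>y \<equiv> c_(i - 1) (mod m)\<close>; conversely, \<open>y - A'_i \<pi>(y)\<close> with
  \<open>y = c_(i - 1)\<close> satisfies them.
\<close>

subsection \<open>Powers of a primitive element\<close>

lemma two_le_CARD_field: "2 \<le> CARD('a::{field,finite})"
proof -
  have "card {0, 1::'a} \<le> CARD('a)" by (intro card_mono) auto
  then show ?thesis by simp
qed

text \<open>Translation by 1 permutes the ring, so the sums of \<open>x\<close> and of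
  \<open>x + 1\<close> over all elements agree.\<close>

lemma of_nat_CARD_eq_0: "of_nat CARD('a) = (0::'a::{ring_1,finite})"
proof -
  have "(\<Sum>x\<in>UNIV. x + 1) = (\<Sum>x\<in>UNIV. x::'a)"
    by (rule sum.reindex_bij_witness[of _ "\<lambda>x. x - 1" "\<lambda>x. x + 1"]) auto
  then show ?thesis by (simp add: sum.distrib)
qed

text \<open>Multiplication by \<open>x\<close> permutes the nonzero elements, so their product,
  which is nonzero, is fixed by the factor \<open>x ^ (q - 1)\<close>.\<close>

lemma field_power_CARD_minus_1:
  fixes x :: "'a::{field,finite}"
  assumes "x \<noteq> 0"
  shows "x ^ (CARD('a) - 1) = 1"
proof -
  let ?P = "\<Prod>y\<in>UNIV - {0::'a}. y"
  have "?P = (\<Prod>y\<in>UNIV - {0}. x * y)"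
    by (rule prod.reindex_bij_witness[of _ "\<lambda>y. x * y" "\<lambda>y. y / x"]) (use assms in auto)
  also have "\<dots> = x ^ (CARD('a) - 1) * ?P"
    by (simp add: prod.distrib card_Diff_singleton)
  finally show ?thesis by simp
qed

lemma primitive_element_nonzero: "primitive_element \<theta> \<Longrightarrow> \<theta> \<noteq> 0"
  unfolding primitive_element_def
  by (metis Diff_iff power_int_1_right rangeI singletonI UNIV_I)

text \<open>Integer exponents are used because \<theta>^(-c_i) occurs and because differences of
  exponents must not be truncated.\<close>

lemma powi_cong:
  fixes \<theta> :: "'a::{field,finite}"
  assumes "\<theta> \<noteq> 0" "[i = j] (mod int (CARD('a) - 1))"
  shows "\<theta> powi i = \<theta> powi j"
proof -
  obtain k where "i = j + int (CARD('a) - 1) * k"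
    using assms(2) by (metis cong_iff_lin cong_sym)
  then have "\<theta> powi i = \<theta> powi j * (\<theta> powi int (CARD('a) - 1)) powi k"
    using assms(1) by (simp add: power_int_add power_int_mult)
  also have "\<theta> powi int (CARD('a) - 1) = 1"
    unfolding power_int_of_nat by (rule field_power_CARD_minus_1[OF assms(1)])
  finally show ?thesis by simp
qed

lemma power_cong:
  fixes \<theta> :: "'a::{field,finite}"
  assumes "\<theta> \<noteq> 0" "[i = j] (mod CARD('a) - 1)"
  shows "\<theta> ^ i = \<theta> ^ j"
  using powi_cong[OF assms(1), of "int i" "int j"] assms(2)
  unfolding cong_int_iff power_int_of_nat by blast

lemma ex_cong_nat_interval:
  assumes "n > 0"
  shows "\<exists>x\<in>{1..n}. [int x = i] (mod int n)"
proof (intro bexI)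
  \<comment> \<open>The shift by one before and after the reduction makes \<open>n\<close>, not 0,
    represent the multiples of \<open>n\<close>, as in \<open>Psi\<close>.\<close>
  let ?x = "nat ((i - 1) mod int n) + 1"
  have "int ?x = (i - 1) mod int n + 1" using assms by simp
  then show "[int ?x = i] (mod int n)"
    by (metis add.commute add_diff_cancel_left' cong_add_rcancel cong_def diff_add_cancel mod_mod_trivial)
  show "?x \<in> {1..n}"
    using assms by (simp add: Suc_le_eq nat_less_iff)
qed

text \<open>Reducing integer exponents modulo q - 1 gives surjectivity; injectivity then follows
  because both sets have q - 1 elements.\<close>

lemma primitive_element_bij_betw:
  fixes \<theta> :: "'a::{field,finite}"
  assumes "primitive_element \<theta>"
  shows "bij_betw (\<lambda>k. \<theta> ^ k) {1..CARD('a) - 1} (UNIV - {0})"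
proof -
  note nz = primitive_element_nonzero[OF assms]
  have "(\<lambda>k. \<theta> ^ k) ` {1..CARD('a) - 1} = UNIV - {0}"
  proof (intro equalityI subsetI)
    fix y :: 'a assume "y \<in> UNIV - {0}"
    then obtain i where i: "y = \<theta> powi i"
      using assms unfolding primitive_element_def by blast
    obtain x where "x \<in> {1..CARD('a) - 1}" "[int x = i] (mod int (CARD('a) - 1))"
      using ex_cong_nat_interval[of "CARD('a) - 1" i] two_le_CARD_field[where 'a = 'a] by auto
    moreover from this have "y = \<theta> ^ x"
      using powi_cong[OF nz] i by (metis power_int_of_nat)
    ultimately show "y \<in> (\<lambda>k. \<theta> ^ k) ` {1..CARD('a) - 1}" by blast
  qed (use nz in auto)
  moreover from this have "inj_on (\<lambda>k. \<theta> ^ k) {1..CARD('a) - 1}"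
    by (intro eq_card_imp_inj_on) (auto simp: card_Diff_singleton)
  ultimately show ?thesis by (simp add: bij_betw_def)
qed

lemma cong_imp_eq_interval:
  fixes x y n :: nat
  assumes "x \<in> {1..n}" "y \<in> {1..n}" "[x = y] (mod n)"
  shows "x = y"
proof -
  \<comment> \<open>After a shift by one both numbers are below \<open>n\<close>, where congruence
    is equality.\<close>
  have "[x - 1 = y - 1] (mod n)"
    using assms cong_add_rcancel_nat[of "x - 1" 1 "y - 1" n] by simp
  then show ?thesis using assms by (auto simp: cong_def)
qed

text \<open>The order of \<theta> is exactly q - 1: among the exponents 1, ..., q - 1, on which
  powers are distinct, q - 1 already gives the value 1.\<close>

lemma primitive_powi_eq_1_iff:
  fixes \<theta> :: "'a::{field,finite}"
  assumes "primitive_element \<theta>"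
  shows "\<theta> powi i = 1 \<longleftrightarrow> int (CARD('a) - 1) dvd i"
proof
  note nz = primitive_element_nonzero[OF assms]
  let ?n = "CARD('a) - 1"
  have n: "?n > 0" using two_le_CARD_field[where 'a = 'a] by simp
  show "\<theta> powi i = 1" if "int ?n dvd i"
    using powi_cong[OF nz, of i 0] that by (simp add: cong_0_iff)
  assume 1: "\<theta> powi i = 1"
  obtain x where x: "x \<in> {1..?n}" "[int x = i] (mod int ?n)"
    using ex_cong_nat_interval[OF n] by blast
  then have "\<theta> ^ x = \<theta> ^ ?n"
    using powi_cong[OF nz x(2)] field_power_CARD_minus_1[OF nz] 1 by simp
  then have "x = ?n"
    using primitive_element_bij_betw[OF assms] x(1) n
    unfolding bij_betw_def by (intro inj_onD[of "\<lambda>k. \<theta> ^ k"]) auto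
  then show "int ?n dvd i"
    using x(2) by (metis cong_dvd_iff dvd_refl)
qed

section \<open>Lifts of permutations of exponents, their composition and inversion\<close>

lemma theta_lift_power:
  fixes \<theta> :: "'a::{field,finite}"
  assumes "primitive_element \<theta>" "k \<in> {1..CARD('a) - 1}"
  shows "theta_lift \<theta> \<pi> (\<theta> ^ k) = \<theta> ^ \<pi> k"
proof -
  have "(THE i. i \<in> {1..CARD('a) - 1} \<and> \<theta> ^ i = \<theta> ^ k) = k"
    using assms primitive_element_bij_betw[OF assms(1)]
    by (intro the_equality) (auto simp: bij_betw_def dest: inj_onD)
  then show ?thesis
    using primitive_element_nonzero[OF assms(1)] by (simp add: theta_lift_def)
qed

lemma primitive_element_cases:
  fixes \<theta> :: "'a::{field,finite}"
  assumes "primitive_element \<theta>"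
  obtains "x = 0" | k where "k \<in> {1..CARD('a) - 1}" "x = \<theta> ^ k"
  using primitive_element_bij_betw[OF assms] unfolding bij_betw_def by blast

lemma theta_lift_compose:
  assumes "primitive_element \<theta>" "\<sigma> permutes {1..CARD('a) - 1}"
  shows "theta_lift \<theta> \<pi> (theta_lift \<theta> \<sigma> x) = theta_lift \<theta> (\<pi> \<circ> \<sigma>) (x::'a::{field,finite})"
proof (cases rule: primitive_element_cases[OF assms(1), of x])
  case 1
  then show ?thesis by (simp add: theta_lift_def)
next
  case (2 k)
  then have "\<sigma> k \<in> {1..CARD('a) - 1}" using permutes_in_image[OF assms(2)] by blast
  with 2 show ?thesis using assms(1) by (simp add: theta_lift_power)
qed

lemma theta_lift_id:
  assumes "primitive_element \<theta>"
  shows "theta_lift \<theta> id x = x"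
  by (cases rule: primitive_element_cases[OF assms, of x])
    (simp_all add: theta_lift_power[OF assms], simp add: theta_lift_def)

lemma theta_lift_inverse:
  fixes \<theta> :: "'a::{field,finite}"
  assumes "primitive_element \<theta>" "\<pi> permutes {1..CARD('a) - 1}"
  shows "bij (theta_lift \<theta> \<pi>)" "inv (theta_lift \<theta> \<pi>) = theta_lift \<theta> (inv \<pi>)"
proof -
  have l: "theta_lift \<theta> (inv \<pi>) (theta_lift \<theta> \<pi> x) = x" for x
    unfolding theta_lift_compose[OF assms] permutes_inv_o(2)[OF assms(2)]
    by (rule theta_lift_id[OF assms(1)])
  have r: "theta_lift \<theta> \<pi> (theta_lift \<theta> (inv \<pi>) x) = x" for x
    unfolding theta_lift_compose[OF assms(1) permutes_inv[OF assms(2)]]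
      permutes_inv_o(1)[OF assms(2)]
    by (rule theta_lift_id[OF assms(1)])
  show "bij (theta_lift \<theta> \<pi>)" by (rule o_bij[of "theta_lift \<theta> (inv \<pi>)"]) (simp_all add: fun_eq_iff l r)
  show "inv (theta_lift \<theta> \<pi>) = theta_lift \<theta> (inv \<pi>)"
    by (rule inv_equality) (rule l r)+
qed

subsection \<open>Piecewise affine permutations\<close>

text \<open>Existence and uniqueness of the representative justify the definite description in
  \<open>Psi\<close>; later arguments can then work with congruences alone.\<close>

lemma Psi_eq_iff:
  assumes "k > 0"
  shows "Psi k a = r \<longleftrightarrow> r \<in> {1..k} \<and> [r = a] (mod k)"
proof -
  obtain s where s: "s \<in> {1..k} \<and> [s = a] (mod k)"
    using ex_cong_nat_interval[OF assms, of "int a"] unfolding cong_int_iff by blast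
  have u: "t = s" if "t \<in> {1..k} \<and> [t = a] (mod k)" for t
  proof (rule cong_imp_eq_interval)
    show "[t = s] (mod k)" using that s cong_trans[of t a k s] by (simp add: cong_sym)
  qed (use that s in auto)
  have "Psi k a = s"
    unfolding Psi_def using s u by (rule the_equality)
  with s u[of r] show ?thesis by auto
qed

lemma Psi_next:
  assumes "i \<in> {1..m}"
  shows "Psi m (i + 1) = (if i = m then 1 else i + 1)"
  using assms by (subst Psi_eq_iff) (auto simp: cong_def mod_Suc)

lemma Psi_prev:
  assumes "i \<in> {1..m}"
  shows "Psi m (i + m - 1) = (if i = 1 then m else i - 1)"
proof -
  obtain j where "i = Suc j" using assms by (cases i) auto
  then show ?thesis using assms by (subst Psi_eq_iff) (auto simp: cong_def)
qed

text \<open>\<open>Psi\<close> can be traded for congruences because \<pi> x already lies in [1, n]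
  and the coordinates of \<open>c\<close> already lie in [1, m].\<close>

lemma is_pap_iff:
  assumes "m > 1" "m dvd n" "n > 0" "a \<in> {1..m} \<rightarrow> {1..n}" "b \<in> {1..m} \<rightarrow> {1..n}"
    "bij_betw c {1..m} {1..m}" "\<pi> permutes {1..n}"
  shows "is_pap n m \<pi> a b c \<longleftrightarrow>
    (\<forall>i\<in>{1..m}. \<forall>x\<in>{1..n}. [x = c i] (mod m) \<longrightarrow>
       [\<pi> x = a i * x + b i] (mod n) \<and> [\<pi> x = c (Psi m (i + 1))] (mod m))"
proof -
  have 1: "Psi m x = c i \<longleftrightarrow> [x = c i] (mod m)" if "i \<in> {1..m}" for i x
    using Psi_eq_iff[of m x "c i"] assms that by (auto simp: bij_betw_def cong_sym_eq)
  have 2: "Psi m (i + 1) \<in> {1..m}" if "i \<in> {1..m}" for i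
    using that by (simp only: Psi_next) auto
  have 3: "\<pi> x = Psi n y \<longleftrightarrow> [\<pi> x = y] (mod n)" if "x \<in> {1..n}" for x y
    using Psi_eq_iff[of n y "\<pi> x"] assms that permutes_in_image[of \<pi> "{1..n}" x]
    by (metis)
  show ?thesis
    unfolding is_pap_def perm_vectors_def using assms 1 2 3 by auto
qed

subsection \<open>The polynomial representation\<close>

lemma poly_E_poly:
  fixes \<theta> :: "'a::{field,finite}"
  assumes \<theta>: "primitive_element \<theta>" and m: "m dvd CARD('a) - 1" "m > 1"
  shows "poly (E_poly m) (\<theta> powi i) = (if int m dvd i then of_nat m else 0)"
proof -
  let ?n = "CARD('a) - 1"
  obtain s where s: "?n = m * s" using m by blast
  have n: "?n > 0" using two_le_CARD_field[where 'a = 'a] by simp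
  \<comment> \<open>Since ms = q - 1, \<open>w\<close> is an m-th root of unity, and it equals 1
    exactly when \<open>m\<close> divides \<open>i\<close>.\<close>
  define w where "w = \<theta> powi (i * int s)"
  have w: "(\<theta> powi i) ^ (?n * j div m) = w ^ j" for j
  proof -
    have "?n * j div m = s * j" using m by (simp only: s mult.assoc) simp
    then show ?thesis by (simp add: w_def power_mult power_int_mult)
  qed
  have "poly (E_poly m) (\<theta> powi i) = (\<Sum>j=0..m-1. w ^ j)"
    unfolding E_poly_def poly_sum poly_monom w by simp
  also have "{0..m - 1} = {..<m}" using m by auto
  finally have E: "poly (E_poly m) (\<theta> powi i) = (\<Sum>j<m. w ^ j)" .
  have w1: "w = 1 \<longleftrightarrow> int m dvd i"
    using n unfolding w_def primitive_powi_eq_1_iff[OF \<theta>] s by simp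
  have "w ^ m = \<theta> powi (i * int s * int m)"
    by (simp only: w_def power_int_mult power_int_of_nat)
  also have "\<dots> = 1"
    unfolding primitive_powi_eq_1_iff[OF \<theta>] s by simp
  finally have "(w - 1) * (\<Sum>j<m. w ^ j) = 0"
    by (simp flip: power_diff_1_eq)
  then show ?thesis using w1 E by auto
qed

text \<open>If \<open>m\<close> vanished in the field, then q = ms + 1 would be 1 there, whereas it
  is 0. This makes the factor 1/m meaningful.\<close>

lemma of_nat_dvd_CARD_minus_1_nonzero:
  assumes "m dvd CARD('a) - 1"
  shows "of_nat m \<noteq> (0::'a::{field,finite})"
proof
  assume 0: "of_nat m = (0::'a)"
  obtain s where "CARD('a) - 1 = m * s" using assms by blast
  then have "CARD('a) = m * s + 1" using two_le_CARD_field[where 'a = 'a] by simp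
  then have "of_nat CARD('a) = (of_nat (m * s + 1) :: 'a)" by (simp only:)
  then show False using 0 by (simp add: of_nat_CARD_eq_0)
qed

lemma pap_poly_representation:
  fixes \<theta> :: "'a::{field,finite}"
  assumes \<theta>: "primitive_element \<theta>" and pap: "is_pap (CARD('a) - 1) m \<pi> a b c"
  shows "poly_representation (pap_poly \<theta> m a b c) (theta_lift \<theta> \<pi>)"
  unfolding poly_representation_def
proof
  fix x :: 'a
  let ?n = "CARD('a) - 1"
  note nz = primitive_element_nonzero[OF \<theta>]
  have n: "?n > 0" using two_le_CARD_field[where 'a = 'a] by simp
  have m: "m > 1" "m dvd ?n" and perm: "\<pi> permutes {1..?n}"
    and a: "a \<in> {1..m} \<rightarrow> {1..?n}" and b: "b \<in> {1..m} \<rightarrow> {1..?n}"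
    and c: "bij_betw c {1..m} {1..m}"
    using pap by (auto simp: is_pap_def perm_vectors_def)
  have aff: "[\<pi> x = a i * x + b i] (mod ?n)"
    if "i \<in> {1..m}" "x \<in> {1..?n}" "[x = c i] (mod m)" for i x
    using pap that unfolding is_pap_iff[OF m n a b c perm] by blast
  show "poly (pap_poly \<theta> m a b c) x = theta_lift \<theta> \<pi> x"
  proof (cases rule: primitive_element_cases[OF \<theta>, of x])
    case 1
    \<comment> \<open>The factor E_m does not vanish at 0, so it is the positivity of a_i that makes
      each summand 0 there, as the lift requires.\<close>
    have "a i \<noteq> 0" if "i \<in> {1..m}" for i using funcset_mem[OF a that] by simp
    then have "(\<Sum>i=1..m. \<theta> ^ b i * (0 ^ a i * e i)) = 0" for e
    proof (intro sum.neutral ballI)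
      fix i assume "i \<in> {1..m}"
      then show "\<theta> ^ b i * (0 ^ a i * e i) = 0"
        using \<open>\<And>i. i \<in> {1..m} \<Longrightarrow> a i \<noteq> 0\<close>[of i] by (simp add: power_0_left)
    qed
    then show ?thesis
      using 1 by (simp add: pap_poly_def poly_sum poly_monom theta_lift_def)
  next
    case (2 k)
    have E: "poly (E_poly m) (\<theta> ^ k * \<theta> powi - int (c i))
        = (if [k = c i] (mod m) then of_nat m else 0)" for i
    proof -
      have "\<theta> ^ k * \<theta> powi - int (c i) = \<theta> powi (int k - int (c i))"
        using nz by (simp add: power_int_diff power_int_minus divide_inverse)
      then show ?thesis
        using poly_E_poly[OF \<theta> m(2,1), of "int k - int (c i)"]
        by (simp only: cong_iff_dvd_diff flip: cong_int_iff)
    qed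
    have "Psi m k \<in> {1..m}" using Psi_eq_iff[of m k "Psi m k"] m by simp
    then obtain i where i: "i \<in> {1..m}" "c i = Psi m k"
      using c unfolding bij_betw_def by (metis imageE)
    \<comment> \<open>The coordinates of \<open>c\<close> are distinct residues modulo
      \<open>m\<close>, so \<open>i\<close> is the only index whose summand survives.\<close>
    have k: "[k = c j] (mod m) \<longleftrightarrow> j = i" if j: "j \<in> {1..m}" for j
    proof -
      have "[k = c j] (mod m) \<longleftrightarrow> c j = c i"
        using Psi_eq_iff[of m k "c j"] bij_betwE[OF c] i(2) m j by (auto simp: cong_sym_eq)
      then show ?thesis using c i(1) j unfolding bij_betw_def by (metis inj_onD)
    qed
    have "poly (pap_poly \<theta> m a b c) x = (\<Sum>j=1..m. \<theta> ^ b j * (\<theta> ^ k) ^ a j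
        * (if [k = c j] (mod m) then of_nat m else 0)) / of_nat m"
      using 2 E by (simp add: pap_poly_def poly_sum poly_monom poly_pcompose mult.assoc)
    also have "(\<Sum>j=1..m. \<theta> ^ b j * (\<theta> ^ k) ^ a j
        * (if [k = c j] (mod m) then of_nat m else 0))
        = (\<Sum>j=1..m. if j = i then \<theta> ^ b j * (\<theta> ^ k) ^ a j * of_nat m else 0)"
      by (rule sum.cong) (auto simp: k)
    also have "\<dots> / of_nat m = \<theta> ^ (a i * k + b i)"
      using i of_nat_dvd_CARD_minus_1_nonzero[OF m(2)]
      by (simp add: power_add mult_ac flip: power_mult)
    \<comment> \<open>The exponents agree only modulo q - 1, which is enough for powers of
      \<theta>.\<close>
    also have "\<dots> = \<theta> ^ \<pi> k"
    proof (rule power_cong[OF nz cong_sym])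
      show "[\<pi> k = a i * k + b i] (mod ?n)" using aff[OF i(1) 2(1)] k[OF i(1)] by simp
    qed
    also have "\<dots> = theta_lift \<theta> \<pi> x"
      using 2 by (simp add: theta_lift_power[OF \<theta>])
    finally show ?thesis .
  qed
qed

text \<open>Scaling the variable creates no new monomials, so every exponent that occurs comes from
  one of the m * m pairs of a summand \<open>i\<close> and a term \<open>j\<close> of E_m.
  Coincidences between pairs only lower the count.\<close>

lemma pap_poly_card_coeffs:
  "card {k. coeff (pap_poly \<theta> m a b c) k \<noteq> 0} \<le> m ^ 2"
proof -
  let ?f = "\<lambda>(i, j). a i + (CARD('a) - 1) * j div m"
  have "{k. coeff (pap_poly \<theta> m a b c) k \<noteq> 0} \<subseteq> ?f ` ({1..m} \<times> {0..m - 1})"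
  proof
    fix k assume "k \<in> {k. coeff (pap_poly \<theta> m a b c) k \<noteq> 0}"
    then have "(\<Sum>i=1..m. coeff (smult (\<theta> ^ b i) (monom 1 (a i) *
        pcompose (E_poly m) [:0, \<theta> powi (- int (c i)):])) k) \<noteq> 0"
      by (auto simp: pap_poly_def coeff_sum)
    then obtain i where i: "i \<in> {1..m}" and
      "coeff (smult (\<theta> ^ b i) (monom 1 (a i) *
        pcompose (E_poly m) [:0, \<theta> powi (- int (c i)):])) k \<noteq> 0"
      by (rule sum.not_neutral_contains_not_neutral)
    then have k: "a i \<le> k" and "coeff (E_poly m :: 'a poly) (k - a i) \<noteq> 0"
      by (auto simp: coeff_monom_mult coeff_pcompose_linear split: if_splits)
    from this(2) obtain j where "j \<in> {0..m - 1}"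
      and "coeff (monom (1::'a) ((CARD('a) - 1) * j div m)) (k - a i) \<noteq> 0"
      unfolding E_poly_def coeff_sum by (rule sum.not_neutral_contains_not_neutral)
    with i k show "k \<in> ?f ` ({1..m} \<times> {0..m - 1})"
      by (force simp: split: if_splits)
  qed
  then have "card {k. coeff (pap_poly \<theta> m a b c) k \<noteq> 0} \<le> card ({1..m} \<times> {0..m - 1})"
    by (intro surj_card_le) auto
  also have "\<dots> = m ^ 2" by (cases m) (simp_all add: power2_eq_square card_cartesian_product)
  finally show ?thesis .
qed

subsection \<open>The inverse permutation\<close>

text \<open>Take \<open>n1\<close> to be the largest divisor of \<open>n\<close> whose primes all
  divide \<open>s\<close>. A prime dividing both \<open>s\<close> and the cofactor could be
  multiplied into \<open>n1\<close>, against maximality.\<close>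

lemma ex_rad_coprime_factorization:
  fixes n s :: nat
  assumes "s dvd n" "n > 0"
  shows "\<exists>n1 n2. n = n1 * n2 \<and> rad n1 dvd s \<and> coprime n2 s"
proof -
  let ?D = "{d. d dvd n \<and> prime_factors d \<subseteq> prime_factors s}"
  have fin: "finite ?D" using assms(2) by (auto intro: finite_subset[OF _ finite_divisors_nat])
  have "1 \<in> ?D" by simp
  define n1 where "n1 = Max ?D"
  have n1: "n1 \<in> ?D" unfolding n1_def using fin \<open>1 \<in> ?D\<close> by (intro Max_in) auto
  then obtain n2 where n2: "n = n1 * n2" by blast
  have s: "s > 0" using assms by (metis dvd_0_left gr0I)
  have "coprime n2 s"
  proof (rule ccontr)
    assume "\<not> coprime n2 s"
    then obtain p where p: "prime p" "p dvd n2" "p dvd s"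
      using prime_factor_nat[of "gcd n2 s"] by (auto simp: coprime_iff_gcd_eq_1)
    then have "n1 * p \<in> ?D"
      using n1 n2 s assms by (auto simp: prime_factors_product in_prime_factors_iff dest: prime_dvd_multD)
    then have "n1 * p \<le> n1" unfolding n1_def using fin by (intro Max_ge)
    moreover have "n1 > 0" using n2 assms(2) by (auto intro: gr0I)
    ultimately show False using prime_gt_1_nat[OF p(1)] by simp
  qed
  \<comment> \<open>The radical of \<open>n1\<close> divides the product of the primes of
    \<open>s\<close>, which divides \<open>s\<close> because each of them has positive
    multiplicity.\<close>
  moreover have "rad n1 dvd (\<Prod>p\<in>prime_factors s. p)"
    unfolding rad_def using n1 by (intro prod_dvd_prod_subset) auto
  moreover have "(\<Prod>p\<in>prime_factors s. p) dvd (\<Prod>p\<in>prime_factors s. p ^ multiplicity p s)"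
    using s by (intro prod_dvd_prod) (auto simp: prime_factors_multiplicity intro!: dvd_power)
  ultimately show ?thesis
    using n2 s by (auto simp: prod_prime_factors intro: dvd_trans)
qed

text \<open>As \<open>n2\<close> divides m * (n div m) and is coprime to the second factor, it
  divides \<open>m\<close>. Every prime of \<open>n1\<close> divides \<open>n div m\<close>, hence
  not \<open>n2\<close>.\<close>

lemma rad_coprime_factorization:
  fixes n m :: nat
  assumes "n = n1 * n2" "m dvd n" "n > 0" "rad n1 dvd n div m" "coprime n2 (n div m)"
  shows "coprime n1 n2" "n2 dvd m"
proof -
  show "n2 dvd m"
    using assms by (metis coprime_dvd_mult_left_iff dvd_mult_div_cancel dvd_triv_right)
  have "p dvd n div m" if "prime p" "p dvd n1" for p
  proof -
    have "p dvd rad n1"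
      unfolding rad_def using that assms by (intro dvd_prodI) (auto simp: in_prime_factors_iff)
    then show ?thesis using assms(4) by (rule dvd_trans)
  qed
  then show "coprime n1 n2"
    using assms(5) prime_factor_nat[of "gcd n1 n2"]
    by (metis coprime_common_divisor coprime_iff_gcd_eq_1 gcd_greatest_iff not_prime_unit)
qed

section \<open>Residue classes and coefficients of a fixed piecewise affine permutation\<close>

context
  fixes n m :: nat and \<pi> a b c :: "nat \<Rightarrow> nat"
  assumes n: "n > 0" and pap: "is_pap n m \<pi> a b c"
begin

lemma pap_simps:
  shows "m > 1" "m dvd n" "\<pi> permutes {1..n}" "a \<in> {1..m} \<rightarrow> {1..n}" "b \<in> {1..m} \<rightarrow> {1..n}"
    "bij_betw c {1..m} {1..m}"
  using pap by (auto simp: is_pap_def perm_vectors_def)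

lemma pap_cong:
  assumes "i \<in> {1..m}" "x \<in> {1..n}" "[x = c i] (mod m)"
  shows "[\<pi> x = a i * x + b i] (mod n)" "[\<pi> x = c (Psi m (i + 1))] (mod m)"
  using pap assms is_pap_iff[OF pap_simps(1,2) n pap_simps(4-6,3)] by blast+

lemma pap_vector_cong_iff:
  assumes "i \<in> {1..m}" "j \<in> {1..m}"
  shows "[c i = c j] (mod m) \<longleftrightarrow> i = j"
proof
  assume "[c i = c j] (mod m)"
  then have "c i = c j"
    using pap_simps(6) assms by (intro cong_imp_eq_interval[of _ m]) (auto simp: bij_betw_def)
  then show "i = j" using pap_simps(6) assms by (auto simp: bij_betw_def dest: inj_onD)
qed simp

lemma pap_ex_class: "\<exists>i\<in>{1..m}. [x = c i] (mod m)"
proof -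
  have "Psi m x \<in> {1..m} \<and> [Psi m x = x] (mod m)"
    using Psi_eq_iff[of m x "Psi m x"] pap_simps(1) by simp
  moreover from this obtain i where "i \<in> {1..m}" "Psi m x = c i"
    using pap_simps(6) unfolding bij_betw_def by blast
  ultimately show ?thesis by (metis cong_sym)
qed

text \<open>\<pi> sends the class of index \<open>i\<close> into that of index \<open>i + 1\<close>,
  and distinct indices have distinct classes, so the class of the image determines that of the
  argument. This is why \<open>c\<close> gets reversed for the inverse.\<close>

lemma pap_prev_class:
  assumes "j \<in> {1..m}" "y \<in> {1..n}" "[\<pi> y = c j] (mod m)"
  shows "[y = c (Psi m (j + m - 1))] (mod m)"
proof -
  obtain i where i: "i \<in> {1..m}" "[y = c i] (mod m)" using pap_ex_class by blast
  have "Psi m (i + 1) \<in> {1..m}" using i by (simp only: Psi_next) auto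
  moreover have "[c (Psi m (i + 1)) = c j] (mod m)"
    using pap_cong(2)[OF i(1) assms(2) i(2)] assms(3) by (meson cong_sym cong_trans)
  ultimately have "Psi m (i + 1) = j" using pap_vector_cong_iff assms(1) by blast
  then have "Psi m (j + m - 1) = i"
    using i(1) assms(1) by (auto simp: Psi_next[OF i(1)] Psi_prev[OF assms(1)] simp del: One_nat_def split: if_splits)
  with i(2) show ?thesis by simp
qed

text \<open>Injectivity of \<pi> forces this: a common prime of a_i and \<open>n1\<close> would make
  the affine map on the class of c_i take one value twice.\<close>

lemma pap_coprime:
  assumes "i \<in> {1..m}" "n1 dvd n" "rad n1 dvd n div m"
  shows "coprime (a i) n1"
proof (rule ccontr)
  assume "\<not> coprime (a i) n1"
  then obtain p where p: "prime p" "p dvd a i" "p dvd n1"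
    using prime_factor_nat[of "gcd (a i) n1"] by (auto simp: coprime_iff_gcd_eq_1)
  have "p dvd rad n1"
    unfolding rad_def using p assms n by (intro dvd_prodI) (auto simp: in_prime_factors_iff)
  then have "p dvd n div m" using assms(3) by (rule dvd_trans)
  then obtain t where "n div m = p * t" by blast
  then have nt: "n = m * (p * t)" using pap_simps(2) by (metis dvd_mult_div_cancel)
  then have t: "t > 0" using n by (auto intro: gr0I)
  \<comment> \<open>Both points are congruent to c_i modulo \<open>m\<close>, and a_i * m * t is a
    multiple of n = mpt because \<open>p\<close> divides a_i.\<close>
  let ?x = "c i" and ?y = "c i + m * t"
  have x: "?x \<in> {1..m}" using pap_simps(6) assms(1) by (auto simp: bij_betw_def)
  \<comment> \<open>From c_i \<le> m and p \<ge> 2 it follows that the second point is still at most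
    \<open>n\<close>.\<close>
  have "m + m * t \<le> m * (2 * t)" using t by simp
  also have "\<dots> \<le> n" unfolding nt using prime_ge_2_nat[OF p(1)] by (intro mult_left_mono mult_right_mono) auto
  finally have xy: "?x \<in> {1..n}" "?y \<in> {1..n}" using x by auto
  obtain k where k: "a i = p * k" using p(2) by blast
  have "[a i * ?x + b i = a i * ?y + b i] (mod n)"
  proof -
    have "a i * ?y + b i = (a i * ?x + b i) + n * k" by (simp add: k nt algebra_simps)
    then show ?thesis by (simp only: cong_def mod_mult_self2)
  qed
  moreover have "[\<pi> ?x = a i * ?x + b i] (mod n)" "[\<pi> ?y = a i * ?y + b i] (mod n)"
    using pap_cong(1)[OF assms(1)] xy by (auto simp: cong_def)
  ultimately have "[\<pi> ?x = \<pi> ?y] (mod n)" by (simp add: cong_def)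
  then have "\<pi> ?x = \<pi> ?y"
    using xy by (intro cong_imp_eq_interval[of _ n]) (simp_all only: permutes_in_image[OF pap_simps(3)])
  then have "?x = ?y" by (rule injD[OF permutes_inj[OF pap_simps(3)]])
  then show False using t pap_simps(1) by simp
qed

lemma pap_ex_inverse_coefficient:
  assumes "i \<in> {1..m}" "n1 dvd n" "rad n1 dvd n div m"
  shows "\<exists>x\<in>{1..n1}. [x * a i = 1] (mod n1)"
proof -
  have n1: "n1 > 0" using assms n by (auto intro: gr0I)
  obtain z where z: "[a i * z = 1] (mod n1)"
    using cong_solve_coprime_nat[OF pap_coprime[OF assms]] by auto
  obtain x where x: "x \<in> {1..n1}" "[x = z] (mod n1)"
    using ex_cong_nat_interval[OF n1, of "int z"] unfolding cong_int_iff by blast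
  have "[x * a i = z * a i] (mod n1)" using x(2) by (rule cong_scalar_right)
  also have "[z * a i = 1] (mod n1)" using z by (simp add: mult.commute)
  finally show ?thesis using x(1) by blast
qed

section \<open>The inverse on a single residue class, with \<open>j\<close> the class index of the
  image, \<open>i\<close> its predecessor and \<open>k\<close> in the role of A'_j\<close>

context
  fixes i j k n1 :: nat
  assumes j: "j \<in> {1..m}" and i: "i = Psi m (j + m - 1)"
    and n1: "n1 dvd n" and k: "[k * a i = 1] (mod n1)"
begin

lemma pap_prev_index: "i \<in> {1..m}" "Psi m (i + 1) = j"
proof -
  show "i \<in> {1..m}" using j unfolding i by (simp only: Psi_prev) auto
  then show "Psi m (i + 1) = j"
    using j unfolding i by (simp only: Psi_prev Psi_next) (auto split: if_splits)
qed

text \<open>Modulo \<open>m\<close> only the classes of \<open>y\<close> and \<pi> y matter. Modulo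
  \<open>n1\<close> the inverse \<open>k\<close> of a_i cancels \<open>y\<close>. Hence both
  residues are the same for all \<open>y\<close> in the class.\<close>

lemma pap_inverse_cong:
  assumes "y \<in> {1..n}" "[y = c i] (mod m)"
  shows "[int y - int k * int (\<pi> y) = int (c i) - int k * int (c j)] (mod int m)"
    "[int y - int k * int (\<pi> y) = - (int k * int (b i))] (mod int n1)"
proof -
  note pc = pap_cong[OF pap_prev_index(1) assms, unfolded pap_prev_index(2)]
  show "[int y - int k * int (\<pi> y) = int (c i) - int k * int (c j)] (mod int m)"
    using assms(2) pc(2) by (intro cong_diff cong_mult) (simp_all add: cong_int_iff)
  have "[int y - int k * int (\<pi> y) = int y - int k * int (a i * y + b i)] (mod int n1)"
    using cong_dvd_modulus_nat[OF pc(1) n1]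
    by (intro cong_diff cong_mult cong_refl) (simp only: cong_int_iff)
  also have "int y - int k * int (a i * y + b i)
      = int y * 1 - int y * int (k * a i) - int k * int (b i)"
    by (simp add: algebra_simps)
  also have "[\<dots> = int y * 1 - int y * int 1 - int k * int (b i)] (mod int n1)"
    using k by (intro cong_diff cong_mult cong_refl) (simp only: cong_int_iff)
  finally show "[int y - int k * int (\<pi> y) = - (int k * int (b i))] (mod int n1)" by simp
qed

text \<open>The moduli \<open>m\<close> and \<open>n1\<close> may share factors, so the Chinese
  remainder theorem does not apply directly; the single point y = c_i supplies a simultaneous
  solution.\<close>

lemma pap_ex_inverse_constant:
  "\<exists>x\<in>{1..n}. [int x = int (c i) - int k * int (c j)] (mod int m) \<and>
     [int x = - (int k * int (b i))] (mod int n1)"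
proof -
  have "c i \<in> {1..m}" using pap_simps(6) pap_prev_index(1) by (auto simp: bij_betw_def)
  then have ci: "c i \<in> {1..n}" using dvd_imp_le[OF pap_simps(2) n] by auto
  obtain x where x: "x \<in> {1..n}" "[int x = int (c i) - int k * int (\<pi> (c i))] (mod int n)"
    using ex_cong_nat_interval[OF n] by blast
  have "[int x = int (c i) - int k * int (\<pi> (c i))] (mod int m)"
    "[int x = int (c i) - int k * int (\<pi> (c i))] (mod int n1)"
    using cong_dvd_modulus[OF x(2)] pap_simps(2) n1 by simp_all
  from this[THEN cong_trans] pap_inverse_cong[OF ci cong_refl] x(1) show ?thesis by blast
qed

lemma pap_inverse_affine:
  assumes "n = n1 * n2" "rad n1 dvd n div m" "coprime n2 (n div m)"
    and l: "[int l = int (c i) - int k * int (c j)] (mod int m)"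
      "[int l = - (int k * int (b i))] (mod int n1)"
    and y: "y \<in> {1..n}" "[y = c i] (mod m)"
  shows "[y = k * \<pi> y + l] (mod n)"
proof -
  note f = rad_coprime_factorization[OF assms(1) pap_simps(2) n assms(2,3)]
  have "[int y - int k * int (\<pi> y) = int l] (mod int m)"
    "[int y - int k * int (\<pi> y) = int l] (mod int n1)"
    by (rule cong_trans[OF pap_inverse_cong(1)[OF y] cong_sym[OF l(1)]],
        rule cong_trans[OF pap_inverse_cong(2)[OF y] cong_sym[OF l(2)]])
  \<comment> \<open>The congruence modulo \<open>m\<close> descends to its divisor
    \<open>n2\<close>, which is coprime to \<open>n1\<close>.\<close>
  then have "[int y - int k * int (\<pi> y) = int l] (mod int n1 * int n2)"
    using f by (intro coprime_cong_mult) (auto intro: cong_dvd_modulus)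
  then have "[int y = int (k * \<pi> y + l)] (mod int n)"
    unfolding assms(1) by (simp add: cong_iff_dvd_diff algebra_simps)
  then show ?thesis by (simp only: cong_int_iff)
qed

end

text \<open>The inverse runs through the classes backwards. Coordinate \<open>i\<close> of the
  reversed vectors has index j = m + 1 - i in the original order, so advancing \<open>i\<close>
  means stepping \<open>j\<close> back.\<close>

lemma is_pap_inv:
  assumes n12: "n = n1 * n2" "rad n1 dvd n div m" "coprime n2 (n div m)"
    and A': "\<And>j. j \<in> {1..m} \<Longrightarrow> A' j \<in> {1..n1} \<and> [A' j * a (Psi m (j + m - 1)) = 1] (mod n1)"
    and B': "\<And>j. j \<in> {1..m} \<Longrightarrow> B' j \<in> {1..n} \<and>
      [int (B' j) = int (c (Psi m (j + m - 1))) - int (A' j) * int (c j)] (mod int m) \<and>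
      [int (B' j) = - (int (A' j) * int (b (Psi m (j + m - 1))))] (mod int n1)"
  shows "is_pap n m (inv \<pi>) (\<lambda>i. A' (m + 1 - i)) (\<lambda>i. B' (m + 1 - i)) (\<lambda>i. c (m + 1 - i))"
proof -
  have n1: "n1 dvd n" "n1 \<le> n" using n12(1) n by auto
  have rev: "m + 1 - i \<in> {1..m}" if "i \<in> {1..m}" for i using that by auto
  have "bij_betw (\<lambda>i. m + 1 - i) {1..m} {1..m}"
    by (rule bij_betw_byWitness[of _ "\<lambda>i. m + 1 - i"]) auto
  then have C: "bij_betw (\<lambda>i. c (m + 1 - i)) {1..m} {1..m}"
    using bij_betw_trans[OF _ pap_simps(6)] by (fastforce simp: comp_def)
  have A: "(\<lambda>i. A' (m + 1 - i)) \<in> {1..m} \<rightarrow> {1..n}" using A' rev n1(2) by fastforce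
  have B: "(\<lambda>i. B' (m + 1 - i)) \<in> {1..m} \<rightarrow> {1..n}" using B' rev by blast
  show ?thesis
    unfolding is_pap_iff[OF pap_simps(1,2) n A B C permutes_inv[OF pap_simps(3)]]
  proof (intro ballI impI)
    fix i x assume i: "i \<in> {1..m}" and x: "x \<in> {1..n}" "[x = c (m + 1 - i)] (mod m)"
    define y where "y = inv \<pi> x"
    have y: "y \<in> {1..n}" "\<pi> y = x"
      using permutes_in_image[OF permutes_inv[OF pap_simps(3)]] x(1) permutes_inverses(1)[OF pap_simps(3)]
      unfolding y_def by blast+
    let ?j = "m + 1 - i"
    note j = rev[OF i]
    have yc: "[y = c (Psi m (?j + m - 1))] (mod m)"
      using pap_prev_class[OF j y(1)] x(2) y(2) by simp
    moreover have "[y = A' ?j * \<pi> y + B' ?j] (mod n)"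
      using A'[OF j] B'[OF j] by (intro pap_inverse_affine[OF j refl n1(1) _ n12 _ _ y(1) yc]) blast+
    \<comment> \<open>Reversal turns the cyclic successor into the cyclic predecessor, also at the
      wrap-around i = m, where j = 1.\<close>
    moreover have "m + 1 - Psi m (i + 1) = Psi m (?j + m - 1)"
      unfolding Psi_next[OF i] Psi_prev[OF j] using i by auto
    ultimately show "[inv \<pi> x = A' ?j * x + B' ?j] (mod n) \<and>
        [inv \<pi> x = c (m + 1 - Psi m (i + 1))] (mod m)"
      using y by (simp add: y_def)
  qed
qed

end

text \<open>The universally quantified factorization, coefficients \<open>A'\<close> and constants
  \<open>B'\<close> are each accompanied by an existence claim, so the assertions about the inverse
  are not vacuous.\<close>

theorem theorem4p3:
  fixes \<theta> :: "'a::{field,finite}"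
    and q m :: nat
    and \<pi> a b c :: "nat \<Rightarrow> nat"
  assumes "q = CARD('a)"
    and "primitive_element \<theta>"
    and "m > 1"
    and "m dvd q - 1"
    and "is_pap (q - 1) m \<pi> a b c"
  shows
    "poly_representation (pap_poly \<theta> m a b c) (theta_lift \<theta> \<pi>) \<and>
     card {k. coeff (pap_poly \<theta> m a b c) k \<noteq> 0} \<le> m ^ 2 \<and>
     (\<exists>n1 n2. q - 1 = n1 * n2 \<and> rad n1 dvd (q - 1) div m \<and> coprime n2 ((q - 1) div m)) \<and>
     (\<forall>n1 n2.
        q - 1 = n1 * n2 \<and> rad n1 dvd (q - 1) div m \<and> coprime n2 ((q - 1) div m) \<longrightarrow>
        (\<forall>i\<in>{1..m}. \<exists>x\<in>{1..n1}. [x * a (Psi m (i + m - 1)) = 1] (mod n1)) \<and>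
        (\<forall>A'.
           (\<forall>i\<in>{1..m}. A' i \<in> {1..n1} \<and> [A' i * a (Psi m (i + m - 1)) = 1] (mod n1)) \<longrightarrow>
           (\<forall>i\<in>{1..m}. \<exists>x\<in>{1..q - 1}.
              [int x = int (c (Psi m (i + m - 1))) - int (A' i) * int (c i)] (mod int m) \<and>
              [int x = - (int (A' i) * int (b (Psi m (i + m - 1))))] (mod int n1)) \<and>
           (\<forall>B'.
              (\<forall>i\<in>{1..m}. B' i \<in> {1..q - 1} \<and>
                 [int (B' i) = int (c (Psi m (i + m - 1))) - int (A' i) * int (c i)] (mod int m) \<and>
                 [int (B' i) = - (int (A' i) * int (b (Psi m (i + m - 1))))] (mod int n1)) \<longrightarrow>
              (let A = (\<lambda>i. A' (m + 1 - i));
                   B = (\<lambda>i. B' (m + 1 - i));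
                   C = (\<lambda>i. c (m + 1 - i))
               in is_pap (q - 1) m (inv \<pi>) A B C \<and>
                  bij (theta_lift \<theta> \<pi>) \<and>
                  inv (theta_lift \<theta> \<pi>) = theta_lift \<theta> (inv \<pi>) \<and>
                  poly_representation (pap_poly \<theta> m A B C) (theta_lift \<theta> (inv \<pi>)) \<and>
                  permutation_poly (pap_poly \<theta> m A B C)))))"
proof -
  note \<theta> = assms(2)
  have n: "q - 1 > 0" using two_le_CARD_field[where 'a = 'a] assms(1) by simp
  note pap = assms(5)
  have perm: "\<pi> permutes {1..CARD('a) - 1}" using pap_simps(3)[OF n pap] assms(1) by simp
  have m: "(q - 1) div m dvd q - 1" using assms(4) by (metis dvd_div_mult_self dvd_triv_left)
  have prev: "Psi m (i + m - 1) \<in> {1..m}" if "i \<in> {1..m}" for i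
    using that by (simp only: Psi_prev) auto
  show ?thesis
    unfolding Let_def
  proof (intro conjI allI impI ballI; (elim conjE)?)
    show "poly_representation (pap_poly \<theta> m a b c) (theta_lift \<theta> \<pi>)"
      using pap_poly_representation[OF \<theta>] pap assms(1) by simp
    show "card {k. coeff (pap_poly \<theta> m a b c) k \<noteq> 0} \<le> m ^ 2"
      by (rule pap_poly_card_coeffs)
    show "\<exists>n1 n2. q - 1 = n1 * n2 \<and> rad n1 dvd (q - 1) div m \<and> coprime n2 ((q - 1) div m)"
      by (rule ex_rad_coprime_factorization[OF m n])
  next
    fix n1 n2 i
    assume "q - 1 = n1 * n2" "rad n1 dvd (q - 1) div m" "i \<in> {1..m}"
    then show "\<exists>x\<in>{1..n1}. [x * a (Psi m (i + m - 1)) = 1] (mod n1)"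
      using pap_ex_inverse_coefficient[OF n pap prev] by simp
  next
    fix n1 n2 i :: nat and A' :: "nat \<Rightarrow> nat"
    assume "q - 1 = n1 * n2" "i \<in> {1..m}"
      and "\<forall>i\<in>{1..m}. A' i \<in> {1..n1} \<and> [A' i * a (Psi m (i + m - 1)) = 1] (mod n1)"
    then show "\<exists>x\<in>{1..q - 1}.
        [int x = int (c (Psi m (i + m - 1))) - int (A' i) * int (c i)] (mod int m) \<and>
        [int x = - (int (A' i) * int (b (Psi m (i + m - 1))))] (mod int n1)"
      by (intro pap_ex_inverse_constant[OF n pap _ refl]) auto
  next
    fix n1 n2 :: nat and A' B' :: "nat \<Rightarrow> nat"
    let ?A = "\<lambda>i. A' (m + 1 - i)" and ?B = "\<lambda>i. B' (m + 1 - i)" and ?C = "\<lambda>i. c (m + 1 - i)"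
    assume n12: "q - 1 = n1 * n2" "rad n1 dvd (q - 1) div m" "coprime n2 ((q - 1) div m)"
      and A': "\<forall>i\<in>{1..m}. A' i \<in> {1..n1} \<and> [A' i * a (Psi m (i + m - 1)) = 1] (mod n1)"
      and B': "\<forall>i\<in>{1..m}. B' i \<in> {1..q - 1} \<and>
         [int (B' i) = int (c (Psi m (i + m - 1))) - int (A' i) * int (c i)] (mod int m) \<and>
         [int (B' i) = - (int (A' i) * int (b (Psi m (i + m - 1))))] (mod int n1)"
    show inv: "is_pap (q - 1) m (inv \<pi>) ?A ?B ?C"
      using A' B' by (intro is_pap_inv[OF n pap n12]) blast+
    show "bij (theta_lift \<theta> \<pi>)" "inv (theta_lift \<theta> \<pi>) = theta_lift \<theta> (inv \<pi>)"
      by (rule theta_lift_inverse[OF \<theta> perm])+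
    show rep: "poly_representation (pap_poly \<theta> m ?A ?B ?C) (theta_lift \<theta> (inv \<pi>))"
      using pap_poly_representation[OF \<theta>] inv assms(1) by simp
    \<comment> \<open>Equality as functions lets the polynomial inherit bijectivity from the lift of
      the permutation \<open>inv \<pi>\<close>.\<close>
    then have "poly (pap_poly \<theta> m ?A ?B ?C) = theta_lift \<theta> (inv \<pi>)"
      by (simp add: poly_representation_def fun_eq_iff)
    then show "permutation_poly (pap_poly \<theta> m ?A ?B ?C)"
      unfolding permutation_poly_def using theta_lift_inverse(1)[OF \<theta> permutes_inv[OF perm]] by simp
  qed
qed

end
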